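(* Let $\mathcal{G}$ be a finite simple graph with $p=|V(\mathcal{G})|$ vertices, $|e(\mathcal{G})|$ edges and first Zagreb index $M_1(\mathcal{G})$, with vertices labelled $v_1,\dots,v_p$ so that the diagonal entries satisfy $\mathrm{CNRS}(\mathcal{G})_{1,1}\ge\cdots\ge\mathrm{CNRS}(\mathcal{G})_{p,p}$; here $\mathrm{CNRS}(\mathcal{G})_{i,i}=d(v_i)(m(v_i)-1)$. Let $\nu_1\ge\cdots\ge\nu_p$ be the eigenvalues of $\mathrm{CNL}(\mathcal{G})$ and $\sigma_1\ge\cdots\ge\sigma_p$ those of $\mathrm{CNSL}(\mathcal{G})$, and let $\alpha$ (resp. $\beta$) be the largest integer in $\{1,\dots,p\}$ with $\nu_\alpha\ge(M_1(\mathcal{G})-2|e(\mathcal{G})|)/p$ (resp. $\sigma_\beta\ge(M_1(\mathcal{G})-2|e(\mathcal{G})|)/p$). Then \[ LE_{CN}(\mathcal{G})\ge2\left(\sum_{i=1}^\alpha\mathrm{CNRS}(\mathcal{G})_{i,i}-\frac{\alpha(M_1(\mathcal{G})-2|e(\mathcal{G})|)}{p}\right),\quad LE^+_{CN}(\mathcal{G})\ge2\left(\sum_{i=1}^\beta\mathrm{CNRS}(\mathcal{G})_{i,i}-\frac{\beta(M_1(\mathcal{G})-2|e(\mathcal{G})|)}{p}\right). \]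
   Context: $d(v)$ is the degree of $v$; $m(v)$ is the average degree of the neighbours of $v$ ($m(v)=0$ if $v$ is isolated), so $d(v)m(v)=\sum_{u\sim v}d(u)$. $M_1(\mathcal{G})=\sum_i d(v_i)^2$. $\mathrm{CN}(\mathcal{G})$ has $(i,j)$-entry $|N(v_i)\cap N(v_j)|$ for $i\neq j$ (open neighbourhoods) and $0$ on the diagonal; $\mathrm{CNRS}(\mathcal{G})$ is the diagonal matrix of its row sums; $\mathrm{CNL}=\mathrm{CNRS}-\mathrm{CN}$, $\mathrm{CNSL}=\mathrm{CNRS}+\mathrm{CN}$; $LE_{CN}(\mathcal{G})=\sum_i|\nu_i-tr(\mathrm{CNRS}(\mathcal{G}))/p|$ and $LE^+_{CN}(\mathcal{G})=\sum_i|\sigma_i-tr(\mathrm{CNRS}(\mathcal{G}))/p|$. *)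

theory Defs
  imports "Graph_Theory.Digraph" "Jordan_Normal_Form.Char_Poly"
begin

text \<open>
  A finite simple graph is an instance of the locale \<^locale>\<open>graph\<close>: a finite loop-free symmetric
  digraph without multiple arcs. An undirected edge is thus a pair of opposite arcs, and the
  edges are counted below as two-element sets of vertices.
\<close>

definition nbhd :: "('a, 'b) pre_digraph \<Rightarrow> 'a \<Rightarrow> 'a set" where
  "nbhd G v = {u \<in> verts G. v \<rightarrow>\<^bsub>G\<^esub> u}"

definition edges :: "('a, 'b) pre_digraph \<Rightarrow> 'a set set" where
  "edges G = {{u, v} | u v. u \<rightarrow>\<^bsub>G\<^esub> v}"

definition vdeg :: "('a, 'b) pre_digraph \<Rightarrow> 'a \<Rightarrow> nat" where
  "vdeg G v = card (nbhd G v)"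

definition avg_nbr_deg :: "('a, 'b) pre_digraph \<Rightarrow> 'a \<Rightarrow> real" where
  "avg_nbr_deg G v =
     (if nbhd G v = {} then 0 else (\<Sum>u\<in>nbhd G v. real (vdeg G u)) / real (card (nbhd G v)))"

definition zagreb1 :: "('a, 'b) pre_digraph \<Rightarrow> nat" where
  "zagreb1 G = (\<Sum>v\<in>verts G. (vdeg G v)\<^sup>2)"

text \<open>
  The matrices are taken with respect to a labelling of the vertices, given as a list \<open>vs\<close>
  that enumerates \<open>verts G\<close> without repetition. Matrix and list indices start at \<open>0\<close>, so the
  vertex \<open>v_i\<close> is \<open>vs ! (i - 1)\<close>.
\<close>

definition labelling :: "('a, 'b) pre_digraph \<Rightarrow> 'a list \<Rightarrow> bool" where
  "labelling G vs \<longleftrightarrow> distinct vs \<and> set vs = verts G"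

definition CN :: "('a, 'b) pre_digraph \<Rightarrow> 'a list \<Rightarrow> real mat" where
  "CN G vs = mat (length vs) (length vs)
     (\<lambda>(i, j). if i = j then 0 else real (card (nbhd G (vs ! i) \<inter> nbhd G (vs ! j))))"

definition CNRS :: "('a, 'b) pre_digraph \<Rightarrow> 'a list \<Rightarrow> real mat" where
  "CNRS G vs = mat (length vs) (length vs)
     (\<lambda>(i, j). if i = j then (\<Sum>k<length vs. CN G vs $$ (i, k)) else 0)"

definition CNL :: "('a, 'b) pre_digraph \<Rightarrow> 'a list \<Rightarrow> real mat" where
  "CNL G vs = CNRS G vs - CN G vs"

definition CNSL :: "('a, 'b) pre_digraph \<Rightarrow> 'a list \<Rightarrow> real mat" where
  "CNSL G vs = CNRS G vs + CN G vs"

text \<open>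
  The real eigenvalues of a matrix, repeated according to algebraic multiplicity, in decreasing
  order. For a symmetric matrix, such as \<open>CNL\<close> and \<open>CNSL\<close>, all eigenvalues are real, so the
  length of the list is the dimension of the matrix.
\<close>

definition eigvals_desc :: "real mat \<Rightarrow> real list" where
  "eigvals_desc A = rev (sorted_list_of_multiset (proots (char_poly A)))"

definition mat_tr :: "real mat \<Rightarrow> real" where
  "mat_tr A = sum_list (diag_mat A)"

definition LE_CN :: "('a, 'b) pre_digraph \<Rightarrow> 'a list \<Rightarrow> real" where
  "LE_CN G vs =
     (\<Sum>x\<leftarrow>eigvals_desc (CNL G vs). \<bar>x - mat_tr (CNRS G vs) / real (card (verts G))\<bar>)"

definition LEplus_CN :: "('a, 'b) pre_digraph \<Rightarrow> 'a list \<Rightarrow> real" where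
  "LEplus_CN G vs =
     (\<Sum>x\<leftarrow>eigvals_desc (CNSL G vs). \<bar>x - mat_tr (CNRS G vs) / real (card (verts G))\<bar>)"

end

theory Submission
  imports Defs
begin

text \<open>
  Both \<open>CNL\<close> and \<open>CNSL\<close> are symmetric with the diagonal of \<open>CNRS\<close>, whose mean is
  \<open>t = (M\<^sub>1 - 2|e|)/p\<close>: counting walks of length two and the handshake lemma give its trace.
  By the spectral theorem the diagonal of a symmetric matrix arises from its eigenvalues by a
  doubly stochastic matrix, so the sum of \<open>|a\<^sub>i\<^sub>i - t|\<close> is at most the sum of \<open>|\<nu>\<^sub>j - t|\<close>. Since
  the deviations \<open>a\<^sub>i\<^sub>i - t\<close> add up to zero, twice any partial sum of them is at most the sum of
  their absolute values. Some eigenvalue is at least the mean, so the sets defining \<open>\<alpha>\<close> and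
  \<open>\<beta>\<close> are nonempty and their maxima are genuine.
\<close>

section \<open>The spectral theorem for real symmetric matrices\<close>

text \<open>A complex eigenvalue \<open>k\<close> with eigenvector \<open>z\<close> exists by the
  fundamental theorem of algebra. Moving the symmetric matrix across the Hermitian product of
  \<open>z\<close> with itself replaces \<open>k\<close> by its conjugate, so \<open>k\<close> is
  real.\<close>

lemma symmetric_real_mat_eigenvalue:
  fixes A :: "real mat"
  assumes A: "A \<in> carrier_mat n n" and sym: "A\<^sup>T = A" and "n > 0"
  shows "\<exists>e. eigenvalue A e"
proof -
  define B where "B = map_mat complex_of_real A"
  have B: "B \<in> carrier_mat n n" using A by (auto simp: B_def)
  have cp: "char_poly B = map_poly of_real (char_poly A)"
    unfolding B_def by (rule of_real_hom.char_poly_hom[OF A])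
  have "degree (char_poly B) = n" using degree_monic_char_poly[OF B] by simp
  then obtain k where k: "poly (char_poly B) k = 0"
    using \<open>n > 0\<close> fundamental_theorem_of_algebra[of "char_poly B"]
    by (metis constant_degree less_irrefl)
  then have "eigenvalue B k" using eigenvalue_root_char_poly[OF B] by simp
  then obtain z where z: "z \<in> carrier_vec n" "z \<noteq> 0\<^sub>v n" and Bz: "B *\<^sub>v z = k \<cdot>\<^sub>v z"
    using B by (auto simp: eigenvalue_def eigenvector_def)
  have symB: "B\<^sup>T = B"
    using arg_cong[OF sym, of "map_mat complex_of_real"] A by (simp add: B_def map_mat_transpose)
  \<comment> \<open>Conjugation passes through \<open>B\<close> because its entries are
    real.\<close>
  have conj: "conjugate (B *\<^sub>v z) = B *\<^sub>v conjugate z"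
    using A z by (intro eq_vecI) (auto simp: B_def scalar_prod_def)
  have "k * (z \<bullet>c z) = (B *\<^sub>v z) \<bullet>c z"
    using z by (simp add: Bz)
  also have "\<dots> = z \<bullet> (B *\<^sub>v conjugate z)"
    using transpose_vec_mult_scalar[OF B _ z(1), of "conjugate z"] z symB by auto
  also have "\<dots> = cnj k * (z \<bullet>c z)"
    using z by (simp add: conj[symmetric] Bz conjugate_smult_vec)
  finally have "k = cnj k"
    using conjugate_square_eq_0_vec[OF z(1)] z(2) by simp
  then have "Im k = 0" by (metis add_cancel_left_left cnj.simps(2) mult_2 neg_equal_zero)
  then obtain r where r: "k = complex_of_real r"
    using that[of "Re k"] by (simp add: complex_eq_iff)
  have "poly (char_poly A) r = 0"
    using k by (simp add: cp r)
  then show ?thesis using eigenvalue_root_char_poly[OF A] by blast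
qed

text \<open>The reflection in the hyperplane orthogonal to \<open>v - e\<close>, with
  \<open>e\<close> the first unit vector, swaps \<open>e\<close> and \<open>v\<close>. Being
  symmetric and its own inverse, it is an orthogonal change of basis whose first basis vector is
  \<open>v\<close>.\<close>

lemma householder_reflection:
  fixes v :: "real vec"
  assumes v: "v \<in> carrier_vec n" and unit: "v \<bullet> v = 1" and n: "n > 0"
  obtains H where "H \<in> carrier_mat n n" "H\<^sup>T = H" "H * H = 1\<^sub>m n" "col H 0 = v"
proof -
  define w where "w i = v $ i - (if i = 0 then 1 else 0)" for i
  define s where "s = (\<Sum>i<n. w i * w i)"
  \<comment> \<open>If \<open>v\<close> is the first unit vector, then \<open>s = 0\<close>, hence \<open>c = 0\<close> and \<open>H\<close> is the identity.\<close>
  define c where "c = 2 / s"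
  define H where "H = mat n n (\<lambda>(i, j). (if i = j then 1 else 0) - c * w i * w j)"
  have vv: "(\<Sum>i<n. v $ i * v $ i) = 1"
    using unit v by (simp add: scalar_prod_def atLeast0LessThan)
  have "s = (\<Sum>i<n. v $ i * v $ i - 2 * (if i = 0 then v $ i else 0) + (if i = 0 then 1 else 0))"
    unfolding s_def w_def by (intro sum.cong) (auto simp: algebra_simps)
  then have s: "s = 2 - 2 * v $ 0"
    using n by (simp add: sum.distrib sum_subtractf sum_distrib_left[symmetric] vv)
  \<comment> \<open>Unlike \<open>c * s = 2\<close>, this form survives \<open>s = 0\<close>, so
    \<open>H * H\<close> needs no case split.\<close>
  have ccs: "c * c * s = 2 * c"
    by (simp add: c_def)
  have H: "H \<in> carrier_mat n n" by (simp add: H_def)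
  moreover have "H\<^sup>T = H" by (intro eq_matI) (auto simp: H_def)
  moreover have "H * H = 1\<^sub>m n"
  proof (intro eq_matI)
    fix i j assume ij: "i < dim_row (1\<^sub>m n)" "j < dim_col (1\<^sub>m n)"
    then have "(H * H) $$ (i, j) = (\<Sum>k<n. ((if i = k then 1 else 0) - c * w i * w k)
        * ((if k = j then 1 else 0) - c * w k * w j))"
      by (simp add: H_def scalar_prod_def atLeast0LessThan)
    also have "\<dots> = (\<Sum>k<n. (if i = k then (if k = j then 1 else 0) - c * w k * w j else 0)
        - (if k = j then c * w i * w k else 0) + c * c * w i * w j * (w k * w k))"
      by (intro sum.cong) (auto simp: algebra_simps)
    also have "\<dots> = (if i = j then 1 else 0) - 2 * c * (w i * w j) + c * c * s * (w i * w j)"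
      using ij by (simp add: sum.distrib sum_subtractf sum_distrib_left[symmetric] s_def[symmetric])
    also have "\<dots> = 1\<^sub>m n $$ (i, j)" using ij by (simp add: ccs)
    finally show "(H * H) $$ (i, j) = 1\<^sub>m n $$ (i, j)" .
  qed (auto simp: H_def)
  moreover have "col H 0 = v"
  proof (intro eq_vecI)
    fix i assume "i < dim_vec v"
    then have i: "i < n" using v by simp
    have "(if i = 0 then 1 else 0) - c * w i * w 0 = v $ i"
    proof (cases "s = 0")
      case True
      then have "w i * w i = 0"
        unfolding s_def using i by (subst (asm) sum_nonneg_eq_0_iff) auto
      then show ?thesis by (auto simp: w_def)
    next
      case False
      \<comment> \<open>As \<open>v\<close> is a unit vector, \<open>s = - 2 * w 0\<close>.\<close>
      then have "c * w 0 = - 1" by (simp add: c_def w_def s field_simps)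
      then have "c * w i * w 0 = - w i" by (metis mult.commute mult.left_commute mult_minus1_right)
      then show ?thesis by (simp add: w_def)
    qed
    then show "col H 0 $ i = v $ i" using i n by (simp add: H_def)
  qed (use H v in auto)
  ultimately show ?thesis using that by blast
qed

lemma mult_block_diag_mat:
  fixes A :: "'a :: semiring_1 mat"
  assumes A: "A \<in> carrier_mat m m" and D: "D \<in> carrier_mat n n"
    and A': "A' \<in> carrier_mat m m" and D': "D' \<in> carrier_mat n n"
  shows "four_block_mat A (0\<^sub>m m n) (0\<^sub>m n m) D * four_block_mat A' (0\<^sub>m m n) (0\<^sub>m n m) D'
    = four_block_mat (A * A') (0\<^sub>m m n) (0\<^sub>m n m) (D * D')"
  using assms
  by (subst mult_four_block_mat[OF A _ _ D A' _ _ D'])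
    (auto simp: left_add_zero_mat[of _ n n] right_add_zero_mat[of _ m m])

text \<open>Deflation: a Householder reflection sends the first unit vector to a unit eigenvector.
  Conjugating by it splits off a block of size one, and the induction hypothesis diagonalises the
  rest.\<close>

theorem symmetric_real_mat_spectral:
  fixes A :: "real mat"
  assumes "A \<in> carrier_mat n n" and "A\<^sup>T = A"
  shows "\<exists>U f. U \<in> carrier_mat n n \<and> U\<^sup>T * U = 1\<^sub>m n \<and> A = U * mat_diag n f * U\<^sup>T"
  using assms
proof (induction n arbitrary: A)
  case 0
  then show ?case by (intro exI[of _ "1\<^sub>m 0"] exI) auto
next
  case (Suc n)
  note A = Suc.prems(1) and sym = Suc.prems(2)
  obtain e u where u: "u \<in> carrier_vec (Suc n)" "u \<noteq> 0\<^sub>v (Suc n)" and Au: "A *\<^sub>v u = e \<cdot>\<^sub>v u"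
    using symmetric_real_mat_eigenvalue[OF A sym] A by (auto simp: eigenvalue_def eigenvector_def)
  define v where "v = (1 / sqrt (u \<bullet> u)) \<cdot>\<^sub>v u"
  have "u \<bullet> u > 0" using conjugate_square_greater_0_vec[OF u(1)] u(2) by simp
  then have vv: "v \<bullet> v = 1" using u by (simp add: v_def field_simps)
  have v: "v \<in> carrier_vec (Suc n)" using u by (simp add: v_def)
  obtain H where H: "H \<in> carrier_mat (Suc n) (Suc n)" and symH: "H\<^sup>T = H"
    and HH: "H * H = 1\<^sub>m (Suc n)" and Hv: "col H 0 = v"
    using householder_reflection[OF v vv] by blast
  have Av: "A *\<^sub>v v = e \<cdot>\<^sub>v v"
    using u A by (simp add: v_def mult_mat_vec[of _ "Suc n" "Suc n"] Au smult_smult_assoc mult.commute)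
  note assoc = assoc_mult_mat[of _ "Suc n" "Suc n" _ "Suc n" _ "Suc n"]
  \<comment> \<open>Since \<open>H\<close> is its own inverse, this is a conjugation, and it keeps
    symmetry.\<close>
  define A' where "A' = H * (A * H)"
  have A': "A' \<in> carrier_mat (Suc n) (Suc n)" using A H by (simp add: A'_def)
  have symA': "A'\<^sup>T = A'"
    using A H by (simp add: A'_def transpose_mult[OF H mult_carrier_mat[OF A H]]
        transpose_mult[OF A H] symH sym assoc)
  have "col A' 0 = H *\<^sub>v (A *\<^sub>v col H 0)"
    by (simp only: A'_def col_mult2[OF H mult_carrier_mat[OF A H] zero_less_Suc]
        col_mult2[OF A H zero_less_Suc])
  also have "\<dots> = e \<cdot>\<^sub>v (H *\<^sub>v col H 0)"
    using H v by (simp add: Hv Av mult_mat_vec)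
  also have "H *\<^sub>v col H 0 = col (H * H) 0"
    by (simp only: col_mult2[OF H H zero_less_Suc])
  \<comment> \<open>The first column is now a multiple of the first unit vector; by symmetry so is
    the first row.\<close>
  finally have colA': "col A' 0 = e \<cdot>\<^sub>v unit_vec (Suc n) 0" by (simp add: HH)
  have A'0: "A' $$ (i, 0) = (if i = 0 then e else 0)" if "i < Suc n" for i
    using arg_cong[OF colA', of "\<lambda>x. x $ i"] that A' by (auto simp: unit_vec_def)
  have A'sym: "A' $$ (i, j) = A' $$ (j, i)" if "i < Suc n" "j < Suc n" for i j
    using arg_cong[OF symA', of "\<lambda>M. M $$ (i, j)"] that A' by simp
  define D where "D = mat n n (\<lambda>(i, j). A' $$ (Suc i, Suc j))"
  have D: "D \<in> carrier_mat n n" by (simp add: D_def)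
  have "D\<^sup>T = D" using A'sym by (intro eq_matI) (auto simp: D_def)
  with Suc.IH[OF D] obtain V g where V: "V \<in> carrier_mat n n" and VV: "V\<^sup>T * V = 1\<^sub>m n"
    and DV: "D = V * mat_diag n g * V\<^sup>T" by blast
  \<comment> \<open>The split-off eigenvalue gets index 0, and those of the block \<open>D\<close>
    shift up by one.\<close>
  define f where "f = case_nat e g"
  define W where "W = four_block_mat (1\<^sub>m 1) (0\<^sub>m 1 n) (0\<^sub>m n 1) V"
  have W: "W \<in> carrier_mat (Suc n) (Suc n)" using V by (auto simp: W_def)
  have WT: "W\<^sup>T = four_block_mat (1\<^sub>m 1) (0\<^sub>m 1 n) (0\<^sub>m n 1) V\<^sup>T"
    unfolding W_def using V by (subst transpose_four_block_mat) auto
  have diag: "mat_diag (Suc n) f = four_block_mat (mat 1 1 (\<lambda>_. e)) (0\<^sub>m 1 n) (0\<^sub>m n 1) (mat_diag n g)"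
    by (intro eq_matI) (auto simp: mat_diag_def f_def split: nat.split)
  have "A' = four_block_mat (mat 1 1 (\<lambda>_. e)) (0\<^sub>m 1 n) (0\<^sub>m n 1) D"
    using A' A'0 A'sym[of 0] by (intro eq_matI) (auto simp: D_def)
  also have "\<dots> = W * mat_diag (Suc n) f * W\<^sup>T"
    unfolding WT diag unfolding W_def using V
    by (simp add: DV mult_block_diag_mat[of _ "Suc 0" _ n] mult_carrier_mat[of _ n n])
  finally have A'W: "A' = W * mat_diag (Suc n) f * W\<^sup>T" .
  have WW: "W\<^sup>T * W = 1\<^sub>m (Suc n)"
    unfolding WT unfolding W_def using V
    by (simp add: mult_block_diag_mat[of _ "Suc 0" _ n] VV four_block_one_mat)
  have HHX: "H * (H * X) = X" if "X \<in> carrier_mat (Suc n) (Suc n)" for X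
    using assoc[OF H H that] that by (simp add: HH)
  have "(H * W)\<^sup>T * (H * W) = 1\<^sub>m (Suc n)"
    using H W by (simp add: transpose_mult[OF H W] symH assoc HHX WW)
  moreover have "H * A' * H = A"
    using A H by (simp add: A'_def assoc HHX HH)
  then have "A = (H * W) * mat_diag (Suc n) f * (H * W)\<^sup>T"
    using H W by (simp add: A'W transpose_mult[OF H W] symH assoc
        mult_carrier_mat[of _ "Suc n" "Suc n" _ "Suc n"])
  ultimately show ?case using H W by (intro exI[of _ "H * W"] exI[of _ f]) auto
qed

section \<open>Eigenvalues and diagonal entries\<close>

lemma proots_prod_linear_factors:
  "proots (\<Prod>a\<leftarrow>as. [:- a, 1 :: 'a :: idom:]) = mset as"
proof (induction as)
  case (Cons a as)
  have "(\<Prod>a\<leftarrow>as. [:- a, 1 :: 'a:]) \<noteq> 0"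
    by (auto simp: prod_list_zero_iff)
  then show ?case using Cons by (simp add: proots_mult del: mult_pCons_left)
qed simp

text \<open>The squared entries of an orthogonal matrix form a doubly stochastic matrix, which maps
  the eigenvalues \<open>f\<close> to the diagonal. As \<open>f\<close> is unordered, it is compared
  with the sorted list as a multiset.\<close>

lemma symmetric_eigvals_desc:
  assumes A: "A \<in> carrier_mat n n" and "A\<^sup>T = A"
  obtains U f where "\<And>i. i < n \<Longrightarrow> A $$ (i, i) = (\<Sum>j<n. (U $$ (i, j))\<^sup>2 * f j)"
    and "\<And>i. i < n \<Longrightarrow> (\<Sum>j<n. (U $$ (i, j))\<^sup>2) = 1"
    and "\<And>j. j < n \<Longrightarrow> (\<Sum>i<n. (U $$ (i, j))\<^sup>2) = 1"
    and "mset (eigvals_desc A) = image_mset f (mset_set {..<n})"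
proof -
  obtain U f where U: "U \<in> carrier_mat n n" and orth: "U\<^sup>T * U = 1\<^sub>m n"
    and AU: "A = U * mat_diag n f * U\<^sup>T"
    using symmetric_real_mat_spectral[OF assms] by blast
  \<comment> \<open>For square matrices a left inverse is also a right inverse, so the rows are
    orthonormal as well as the columns.\<close>
  have orth': "U * U\<^sup>T = 1\<^sub>m n"
    using mat_mult_left_right_inverse[OF _ U orth] U by simp
  have diag: "A $$ (i, i) = (\<Sum>j<n. (U $$ (i, j))\<^sup>2 * f j)" if "i < n" for i
    unfolding AU mat_diag_mult_right[OF U] using that U
    by (simp add: scalar_prod_def atLeast0LessThan power2_eq_square mult_ac)
  have row: "(\<Sum>j<n. (U $$ (i, j))\<^sup>2) = 1" if "i < n" for i
    using arg_cong[OF orth', of "\<lambda>M. M $$ (i, i)"] that U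
    by (simp add: scalar_prod_def atLeast0LessThan power2_eq_square)
  have col: "(\<Sum>i<n. (U $$ (i, j))\<^sup>2) = 1" if "j < n" for j
    using arg_cong[OF orth, of "\<lambda>M. M $$ (j, j)"] that U
    by (simp add: scalar_prod_def atLeast0LessThan power2_eq_square)
  \<comment> \<open>Similarity preserves the characteristic polynomial, hence algebraic
    multiplicities.\<close>
  have "similar_mat A (mat_diag n f)"
    unfolding similar_mat_def using A U similar_mat_witI[OF orth' orth AU] by auto
  then have "char_poly A = char_poly (mat_diag n f)" by (rule char_poly_similar)
  also have "\<dots> = (\<Prod>a\<leftarrow>map f [0..<n]. [:- a, 1:])"
    by (subst char_poly_upper_triangular[of _ n])
      (auto simp: mat_diag_def diag_mat_def upper_triangular_def o_def intro!: arg_cong[of _ _ prod_list])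
  finally have "mset (eigvals_desc A) = mset (map f [0..<n])"
    by (simp only: eigvals_desc_def mset_rev mset_sorted_list_of_multiset proots_prod_linear_factors)
  then have "mset (eigvals_desc A) = image_mset f (mset_set {..<n})"
    by (simp add: atLeast0LessThan)
  with that diag row col show ?thesis by blast
qed

lemma sum_list_eigvals_desc:
  assumes "mset (eigvals_desc A) = image_mset f (mset_set {..<n})"
  shows "(\<Sum>x\<leftarrow>eigvals_desc A. g x) = (\<Sum>j<n. g (f j))"
  by (simp add: sum_unfold_sum_mset assms multiset.map_comp o_def flip: sum_mset_sum_list)

section \<open>Trace, mean and absolute deviations of a symmetric matrix\<close>

context
  fixes A :: "real mat" and n
  assumes A: "A \<in> carrier_mat n n" and sym: "A\<^sup>T = A"
begin

lemma length_eigvals_desc: "length (eigvals_desc A) = n"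
proof -
  obtain f where "mset (eigvals_desc A) = image_mset f (mset_set {..<n})"
    by (rule symmetric_eigvals_desc[OF A sym]) (blast intro: that)
  from arg_cong[OF this, of size] show ?thesis by simp
qed

lemma sum_eigvals_desc: "(\<Sum>x\<leftarrow>eigvals_desc A. x) = (\<Sum>i<n. A $$ (i, i))"
proof -
  obtain U f where diag: "\<And>i. i < n \<Longrightarrow> A $$ (i, i) = (\<Sum>j<n. (U $$ (i, j))\<^sup>2 * f j)"
    and col: "\<And>j. j < n \<Longrightarrow> (\<Sum>i<n. (U $$ (i, j))\<^sup>2) = 1"
    and ev: "mset (eigvals_desc A) = image_mset f (mset_set {..<n})"
    by (rule symmetric_eigvals_desc[OF A sym]) (blast intro: that)
  have "(\<Sum>i<n. A $$ (i, i)) = (\<Sum>i<n. \<Sum>j<n. (U $$ (i, j))\<^sup>2 * f j)"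
    by (simp add: diag)
  also have "\<dots> = (\<Sum>j<n. \<Sum>i<n. (U $$ (i, j))\<^sup>2 * f j)" by (rule sum.swap)
  also have "\<dots> = (\<Sum>j<n. f j)" by (simp add: sum_distrib_right[symmetric] col)
  finally show ?thesis by (simp only: sum_list_eigvals_desc[OF ev, of "\<lambda>x. x"])
qed

text \<open>Each diagonal entry is a weighted mean of eigenvalues, so the triangle inequality bounds
  its deviation by the same mean of theirs. Over all rows, each eigenvalue receives total weight
  1.\<close>

lemma sum_abs_diag_le_eigvals_desc:
  "(\<Sum>i<n. \<bar>A $$ (i, i) - t\<bar>) \<le> (\<Sum>x\<leftarrow>eigvals_desc A. \<bar>x - t\<bar>)"
proof -
  obtain U f where diag: "\<And>i. i < n \<Longrightarrow> A $$ (i, i) = (\<Sum>j<n. (U $$ (i, j))\<^sup>2 * f j)"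
    and row: "\<And>i. i < n \<Longrightarrow> (\<Sum>j<n. (U $$ (i, j))\<^sup>2) = 1"
    and col: "\<And>j. j < n \<Longrightarrow> (\<Sum>i<n. (U $$ (i, j))\<^sup>2) = 1"
    and ev: "mset (eigvals_desc A) = image_mset f (mset_set {..<n})"
    by (rule symmetric_eigvals_desc[OF A sym]) (blast intro: that)
  \<comment> \<open>The weights in a row sum to 1, so \<open>t\<close> can be moved inside the
    sum.\<close>
  have "A $$ (i, i) - t = (\<Sum>j<n. (U $$ (i, j))\<^sup>2 * (f j - t))" if "i < n" for i
    using that by (simp add: diag right_diff_distrib sum_subtractf sum_distrib_right[symmetric] row)
  then have "(\<Sum>i<n. \<bar>A $$ (i, i) - t\<bar>) = (\<Sum>i<n. \<bar>\<Sum>j<n. (U $$ (i, j))\<^sup>2 * (f j - t)\<bar>)"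
    by simp
  also have "\<dots> \<le> (\<Sum>i<n. \<Sum>j<n. (U $$ (i, j))\<^sup>2 * \<bar>f j - t\<bar>)"
    by (intro sum_mono order_trans[OF sum_abs]) (simp add: abs_mult)
  also have "\<dots> = (\<Sum>j<n. \<Sum>i<n. (U $$ (i, j))\<^sup>2 * \<bar>f j - t\<bar>)" by (rule sum.swap)
  also have "\<dots> = (\<Sum>j<n. \<bar>f j - t\<bar>)" by (simp add: sum_distrib_right[symmetric] col)
  finally show ?thesis by (simp only: sum_list_eigvals_desc[OF ev])
qed

text \<open>If every eigenvalue were below \<open>t\<close>, their sum, which is the trace, would be
  below \<open>n * t\<close>.\<close>

lemma eigvals_desc_ge_mean:
  assumes "(\<Sum>i<n. A $$ (i, i)) = real n * t" and "n > 0"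
  shows "\<exists>k\<in>{1..n}. eigvals_desc A ! (k - 1) \<ge> t"
proof (rule ccontr)
  assume "\<not> ?thesis"
  then have "eigvals_desc A ! (Suc i - 1) < t" if "i < n" for i
    using that by (intro not_le_imp_less) (metis Suc_leI atLeastAtMost_iff le_add1 plus_1_eq_Suc)
  then have "eigvals_desc A ! i < t" if "i < n" for i
    using that by simp
  then have "(\<Sum>i<n. eigvals_desc A ! i) < (\<Sum>i<n. t)"
    using \<open>n > 0\<close> by (intro sum_strict_mono) auto
  moreover have "(\<Sum>i<n. eigvals_desc A ! i) = real n * t"
    using sum_eigvals_desc assms by (simp add: sum_list_sum_nth length_eigvals_desc atLeast0LessThan)
  ultimately show False by simp
qed

lemma eigvals_desc_deviation_bound:
  assumes tr: "(\<Sum>i<n. A $$ (i, i)) = real n * t" and "n > 0"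
    and k: "k = Max {k \<in> {1..n}. eigvals_desc A ! (k - 1) \<ge> t}"
  shows "2 * ((\<Sum>i<k. A $$ (i, i)) - real k * t) \<le> (\<Sum>x\<leftarrow>eigvals_desc A. \<bar>x - t\<bar>)"
proof -
  let ?a = "\<lambda>i. A $$ (i, i) - t"
  \<comment> \<open>Nonemptiness makes the maximum a member of the set; this yields
    \<open>k \<le> n\<close> for the splitting below.\<close>
  have "k \<in> {k \<in> {1..n}. eigvals_desc A ! (k - 1) \<ge> t}"
    unfolding k using eigvals_desc_ge_mean[OF tr \<open>n > 0\<close>] by (intro Max_in) auto
  then have split: "{..<n} = {..<k} \<union> {k..<n}" by auto
  have sp: "(\<Sum>i<n. g i) = (\<Sum>i<k. g i) + (\<Sum>i=k..<n. g i)" for g :: "nat \<Rightarrow> real"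
    unfolding split by (rule sum.union_disjoint) auto
  have "(\<Sum>i<n. ?a i) = 0" by (simp add: sum_subtractf tr)
  \<comment> \<open>As all deviations add up to zero, one copy of the partial sum is replaced by
    minus the tail.\<close>
  then have "2 * (\<Sum>i<k. ?a i) = (\<Sum>i<k. ?a i) - (\<Sum>i=k..<n. ?a i)"
    unfolding sp by simp
  also have "\<dots> \<le> (\<Sum>i<k. \<bar>?a i\<bar>) + (\<Sum>i=k..<n. \<bar>?a i\<bar>)"
    unfolding diff_conv_add_uminus sum_negf[symmetric] by (intro add_mono sum_mono) auto
  also have "\<dots> = (\<Sum>i<n. \<bar>?a i\<bar>)" by (simp only: sp)
  also have "\<dots> \<le> (\<Sum>x\<leftarrow>eigvals_desc A. \<bar>x - t\<bar>)" by (rule sum_abs_diag_le_eigvals_desc)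
  finally show ?thesis by (simp add: sum_subtractf)
qed

end

section \<open>Common neighbourhood matrices\<close>

context graph begin

lemma finite_nbhd: "finite (nbhd G v)"
  by (simp add: nbhd_def)

lemma in_nbhd_iff: "u \<in> nbhd G v \<longleftrightarrow> v \<rightarrow>\<^bsub>G\<^esub> u"
  by (auto simp: nbhd_def adj_in_verts)

lemma nbhd_subset: "nbhd G v \<subseteq> verts G"
  by (auto simp: nbhd_def)

lemma nbhd_sym: "u \<in> nbhd G v \<longleftrightarrow> v \<in> nbhd G u"
  using sym_arcs by (auto simp: nbhd_def symmetric_def sym_def)

text \<open>Both sides count walks \<open>v\<close>, \<open>u\<close>, \<open>w\<close> with
  \<open>w\<close> different from \<open>v\<close>: once by the endpoint \<open>w\<close>, once by
  the middle vertex \<open>u\<close>.\<close>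

lemma sum_common_nbrs:
  assumes "v \<in> verts G"
  shows "(\<Sum>w\<in>verts G - {v}. real (card (nbhd G v \<inter> nbhd G w))) = (\<Sum>u\<in>nbhd G v. real (vdeg G u) - 1)"
proof -
  have "(\<Sum>w\<in>verts G - {v}. real (card (nbhd G v \<inter> nbhd G w)))
      = (\<Sum>w\<in>verts G - {v}. \<Sum>u\<in>nbhd G v. if u \<in> nbhd G w then 1 else 0)"
    by (simp add: sum.inter_restrict[symmetric] finite_nbhd)
  also have "\<dots> = (\<Sum>u\<in>nbhd G v. \<Sum>w\<in>verts G - {v}. if w \<in> nbhd G u then 1 else 0)"
    by (subst sum.swap) (simp add: nbhd_sym)
  also have "\<dots> = (\<Sum>u\<in>nbhd G v. real (card ((verts G - {v}) \<inter> nbhd G u)))"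
    by (simp add: sum.inter_restrict[symmetric])
  also have "\<dots> = (\<Sum>u\<in>nbhd G v. real (vdeg G u) - 1)"
  proof (rule sum.cong[OF refl])
    fix u assume "u \<in> nbhd G v"
    then have v: "v \<in> nbhd G u" by (simp add: nbhd_sym)
    have "(verts G - {v}) \<inter> nbhd G u = nbhd G u - {v}" using nbhd_subset by blast
    \<comment> \<open>Positivity keeps the subtraction of 1 on naturals exact when it is cast to the
      reals.\<close>
    moreover have "card (nbhd G u) > 0" using v finite_nbhd card_gt_0_iff by blast
    ultimately show "real (card ((verts G - {v}) \<inter> nbhd G u)) = real (vdeg G u) - 1"
      using v by (simp add: vdeg_def card_Diff_singleton of_nat_diff finite_nbhd)
  qed
  finally show ?thesis .
qed

text \<open>At an isolated vertex both sides are 0.\<close>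

lemma sum_vdeg_nbhd: "(\<Sum>u\<in>nbhd G v. real (vdeg G u)) = real (vdeg G v) * avg_nbr_deg G v"
  by (simp add: avg_nbr_deg_def vdeg_def finite_nbhd)

text \<open>The degree sum counts ordered adjacent pairs. Forgetting the order maps them onto the
  edges with fibres of size two, since there are no loops.\<close>

lemma handshake: "(\<Sum>v\<in>verts G. vdeg G v) = 2 * card (edges G)"
proof -
  let ?P = "SIGMA v:verts G. nbhd G v"
  let ?e = "\<lambda>(u, v). {u, v}"
  have P: "finite ?P" by (simp add: finite_nbhd)
  have P_eq: "?P = {(u, v). u \<rightarrow>\<^bsub>G\<^esub> v}"
    by (auto simp: in_nbhd_iff adj_in_verts)
  have "edges G = ?e ` ?P"
    unfolding P_eq by (auto simp: edges_def)
  then have edges: "finite (edges G)" "?e ` ?P \<subseteq> edges G" using P by auto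
  have fibre: "card {x \<in> ?P. ?e x = s} = 2" if "s \<in> edges G" for s
  proof -
    from that obtain u v where s: "s = {u, v}" and uv: "u \<rightarrow>\<^bsub>G\<^esub> v"
      by (auto simp: edges_def)
    have "u \<noteq> v" using uv adj_not_same by blast
    moreover have "v \<rightarrow>\<^bsub>G\<^esub> u" using uv nbhd_sym in_nbhd_iff by blast
    ultimately have "{x \<in> ?P. ?e x = s} = {(u, v), (v, u)}"
      unfolding P_eq using uv by (auto simp: s doubleton_eq_iff)
    then show ?thesis using \<open>u \<noteq> v\<close> by simp
  qed
  have "(\<Sum>v\<in>verts G. vdeg G v) = card ?P"
    by (simp add: vdeg_def card_SigmaI finite_nbhd)
  also have "\<dots> = (\<Sum>s\<in>edges G. card {x \<in> ?P. ?e x = s})"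
    using sum.group[OF P edges, of "\<lambda>_. 1 :: nat"] by simp
  also have "\<dots> = 2 * card (edges G)" by (simp add: fibre)
  finally show ?thesis .
qed

text \<open>After swapping the sums, each vertex contributes its degree once per neighbour, hence
  its square.\<close>

lemma sum_sum_vdeg_nbhd: "(\<Sum>v\<in>verts G. \<Sum>u\<in>nbhd G v. real (vdeg G u)) = real (zagreb1 G)"
proof -
  have "(\<Sum>v\<in>verts G. \<Sum>u\<in>nbhd G v. real (vdeg G u))
      = (\<Sum>v\<in>verts G. \<Sum>u\<in>verts G. if u \<in> nbhd G v then real (vdeg G u) else 0)"
    by (simp add: sum.inter_restrict[symmetric] Int_absorb1 nbhd_subset)
  also have "\<dots> = (\<Sum>u\<in>verts G. \<Sum>v\<in>verts G. if v \<in> nbhd G u then real (vdeg G u) else 0)"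
    by (subst sum.swap) (simp add: nbhd_sym)
  also have "\<dots> = real (zagreb1 G)"
    by (simp add: sum.inter_restrict[symmetric] Int_absorb1 nbhd_subset zagreb1_def
        vdeg_def[symmetric] power2_eq_square)
  finally show ?thesis .
qed

section \<open>Row sums and trace of \<open>CNRS\<close> under a labelling\<close>

context
  fixes vs assumes lab: "labelling G vs"
begin

lemma length_labelling: "length vs = card (verts G)"
  using lab by (metis distinct_card labelling_def)

lemma bij_labelling: "bij_betw ((!) vs) {..<length vs} (verts G)"
  using lab by (auto simp: labelling_def intro: bij_betw_nth)

lemma CNRS_diag:
  assumes i: "i < length vs"
  shows "CNRS G vs $$ (i, i) = (\<Sum>u\<in>nbhd G (vs ! i). real (vdeg G u) - 1)"
proof -
  have v: "vs ! i \<in> verts G"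
    using i lab nth_mem[OF i] unfolding labelling_def by blast
  \<comment> \<open>Distinct labels turn the test on indices into one on vertices, so that the row
    sum can be reindexed over \<open>verts G\<close>.\<close>
  have dist: "vs ! k = vs ! i \<longleftrightarrow> i = k" if "k < length vs" for k
    using lab nth_eq_iff_index_eq[OF _ i that] unfolding labelling_def by metis
  have "CNRS G vs $$ (i, i) = (\<Sum>k<length vs. if vs ! k = vs ! i then 0
      else real (card (nbhd G (vs ! i) \<inter> nbhd G (vs ! k))))"
    using i by (auto simp: CNRS_def CN_def dist intro!: sum.cong)
  also have "\<dots> = (\<Sum>w\<in>verts G. if w = vs ! i then 0 else real (card (nbhd G (vs ! i) \<inter> nbhd G w)))"
    by (rule sum.reindex_bij_betw[OF bij_labelling])
  also have "\<dots> = (\<Sum>w\<in>verts G - {vs ! i}. real (card (nbhd G (vs ! i) \<inter> nbhd G w)))"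
    by (subst sum.remove[OF _ v]) (auto intro!: sum.cong)
  finally show ?thesis by (simp add: sum_common_nbrs v)
qed

lemma CNRS_diag_avg:
  assumes "i < length vs"
  shows "CNRS G vs $$ (i, i) = real (vdeg G (vs ! i)) * (avg_nbr_deg G (vs ! i) - 1)"
  unfolding CNRS_diag[OF assms]
  by (simp add: sum_subtractf sum_vdeg_nbhd vdeg_def[symmetric] algebra_simps)

lemma sum_CNRS_diag:
  "(\<Sum>i<length vs. CNRS G vs $$ (i, i)) = real (zagreb1 G) - 2 * real (card (edges G))"
proof -
  have "(\<Sum>i<length vs. CNRS G vs $$ (i, i))
      = (\<Sum>i<length vs. \<Sum>u\<in>nbhd G (vs ! i). real (vdeg G u) - 1)"
    by (simp add: CNRS_diag)
  also have "\<dots> = (\<Sum>v\<in>verts G. \<Sum>u\<in>nbhd G v. real (vdeg G u) - 1)"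
    by (rule sum.reindex_bij_betw[OF bij_labelling])
  also have "\<dots> = real (zagreb1 G) - real (\<Sum>v\<in>verts G. vdeg G v)"
    by (simp add: sum_subtractf sum_sum_vdeg_nbhd vdeg_def[symmetric])
  finally show ?thesis by (simp add: handshake)
qed

end
end

section \<open>Symmetry and diagonals of the two Laplacians, and the final bound\<close>

lemma CNRS_carrier: "CNRS G vs \<in> carrier_mat (length vs) (length vs)"
  by (simp add: CNRS_def)

lemma CN_carrier: "CN G vs \<in> carrier_mat (length vs) (length vs)"
  by (simp add: CN_def)

lemma CNRS_sym: "(CNRS G vs)\<^sup>T = CNRS G vs"
  by (intro eq_matI) (auto simp: CNRS_def)

lemma CN_sym: "(CN G vs)\<^sup>T = CN G vs"
  by (intro eq_matI) (auto simp: CN_def Int_commute)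

lemma CNL_carrier: "CNL G vs \<in> carrier_mat (length vs) (length vs)"
  unfolding CNL_def by (rule minus_carrier_mat[OF CN_carrier])

lemma CNSL_carrier: "CNSL G vs \<in> carrier_mat (length vs) (length vs)"
  unfolding CNSL_def by (rule add_carrier_mat[OF CN_carrier])

lemma CNL_sym: "(CNL G vs)\<^sup>T = CNL G vs"
  by (simp add: CNL_def CNRS_sym CN_sym transpose_minus[OF CNRS_carrier CN_carrier])

lemma CNSL_sym: "(CNSL G vs)\<^sup>T = CNSL G vs"
  by (simp add: CNSL_def CNRS_sym CN_sym transpose_add[OF CNRS_carrier CN_carrier])

text \<open>The diagonal of \<open>CN\<close> is zero, so the sign in front of it does not matter
  here.\<close>

lemma CNL_diag: "i < length vs \<Longrightarrow> CNL G vs $$ (i, i) = CNRS G vs $$ (i, i)"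
  and CNSL_diag: "i < length vs \<Longrightarrow> CNSL G vs $$ (i, i) = CNRS G vs $$ (i, i)"
  by (simp_all add: CNL_def CNSL_def CN_def CNRS_def)

lemma mat_tr_CNRS: "mat_tr (CNRS G vs) = (\<Sum>i<length vs. CNRS G vs $$ (i, i))"
  by (simp add: mat_tr_def diag_mat_def CNRS_def interv_sum_list_conv_sum_set_nat atLeast0LessThan)

text \<open>Stated for any symmetric \<open>A\<close> with the diagonal of \<open>CNRS\<close>, so
  that it serves \<open>CNL\<close> and \<open>CNSL\<close> alike.\<close>

lemma (in graph) deviation_bound_CNRS_diag:
  assumes lab: "labelling G vs" and "verts G \<noteq> {}" and p: "p = card (verts G)"
    and t: "t = (real (zagreb1 G) - 2 * real (card (edges G))) / real p"
    and A: "A \<in> carrier_mat (length vs) (length vs)" and sym: "A\<^sup>T = A"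
    and diag: "\<And>i. i < length vs \<Longrightarrow> A $$ (i, i) = CNRS G vs $$ (i, i)"
    and \<nu>: "\<And>i. i \<in> {1..p} \<Longrightarrow> \<nu> i = eigvals_desc A ! (i - 1)"
    and k: "k = Max {k \<in> {1..p}. \<nu> k \<ge> t}"
  shows "2 * ((\<Sum>i<k. CNRS G vs $$ (i, i)) - real k * t)
    \<le> (\<Sum>x\<leftarrow>eigvals_desc A. \<bar>x - mat_tr (CNRS G vs) / real (card (verts G))\<bar>)"
proof -
  have len: "length vs = p" unfolding p by (rule length_labelling[OF lab])
  have "p > 0" using assms(2) p by (simp add: card_gt_0_iff)
  have sumCNRS: "(\<Sum>i<p. CNRS G vs $$ (i, i)) = real p * t"
    using sum_CNRS_diag[OF lab] \<open>p > 0\<close> by (simp add: len t)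
  then have tr: "(\<Sum>i<p. A $$ (i, i)) = real p * t"
    by (simp add: diag len)
  have set: "{k \<in> {1..p}. \<nu> k \<ge> t} = {k \<in> {1..p}. eigvals_desc A ! (k - 1) \<ge> t}"
    using \<nu> by auto
  have "mat_tr (CNRS G vs) / real (card (verts G)) = t"
    using \<open>p > 0\<close> by (simp add: mat_tr_CNRS len sumCNRS flip: p)
  \<comment> \<open>This allows the first \<open>k\<close> diagonal entries of \<open>A\<close> to
    be replaced by those of \<open>CNRS\<close>.\<close>
  moreover have "k \<le> p"
    unfolding k set using eigvals_desc_ge_mean[OF A sym, unfolded len, OF tr \<open>p > 0\<close>]
    by (subst Max_le_iff) auto
  ultimately show ?thesis
    using eigvals_desc_deviation_bound[OF A sym, unfolded len, OF tr \<open>p > 0\<close> k[unfolded set]]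
    by (simp add: diag len)
qed

theorem theorem5p5:
  fixes G :: "('a, 'b) pre_digraph"
    and vs :: "'a list"
    and p \<alpha> \<beta> :: nat
    and t :: real
    and \<nu> \<sigma> :: "nat \<Rightarrow> real"
  assumes "graph G"
    and "verts G \<noteq> {}"
    and "p = card (verts G)"
    and "labelling G vs"
    and "\<And>i j. i \<le> j \<Longrightarrow> j < p \<Longrightarrow> CNRS G vs $$ (i, i) \<ge> CNRS G vs $$ (j, j)"
    and "t = (real (zagreb1 G) - 2 * real (card (edges G))) / real p"
    and "\<And>i. i \<in> {1..p} \<Longrightarrow> \<nu> i = eigvals_desc (CNL G vs) ! (i - 1)"
    and "\<And>i. i \<in> {1..p} \<Longrightarrow> \<sigma> i = eigvals_desc (CNSL G vs) ! (i - 1)"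
    and "\<alpha> = Max {k \<in> {1..p}. \<nu> k \<ge> t}"
    and "\<beta> = Max {k \<in> {1..p}. \<sigma> k \<ge> t}"
  shows "(\<forall>i<p. CNRS G vs $$ (i, i) = real (vdeg G (vs ! i)) * (avg_nbr_deg G (vs ! i) - 1))
    \<and> LE_CN G vs \<ge> 2 * ((\<Sum>i<\<alpha>. CNRS G vs $$ (i, i))
        - real \<alpha> * (real (zagreb1 G) - 2 * real (card (edges G))) / real p)
    \<and> LEplus_CN G vs \<ge> 2 * ((\<Sum>i<\<beta>. CNRS G vs $$ (i, i))
        - real \<beta> * (real (zagreb1 G) - 2 * real (card (edges G))) / real p)"
proof -
  interpret graph G by fact
  note bound = deviation_bound_CNRS_diag[OF assms(4,2,3,6)]
  have "\<forall>i<p. CNRS G vs $$ (i, i) = real (vdeg G (vs ! i)) * (avg_nbr_deg G (vs ! i) - 1)"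
    using CNRS_diag_avg[OF assms(4)] by (simp add: length_labelling[OF assms(4)] assms(3))
  moreover have "LE_CN G vs \<ge> 2 * ((\<Sum>i<\<alpha>. CNRS G vs $$ (i, i)) - real \<alpha> * t)"
    unfolding LE_CN_def by (rule bound[OF CNL_carrier CNL_sym CNL_diag assms(7,9)])
  moreover have "LEplus_CN G vs \<ge> 2 * ((\<Sum>i<\<beta>. CNRS G vs $$ (i, i)) - real \<beta> * t)"
    unfolding LEplus_CN_def by (rule bound[OF CNSL_carrier CNSL_sym CNSL_diag assms(8,10)])
  ultimately show ?thesis by (simp only: assms(6) times_divide_eq_right)
qed

end
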